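(* For each $n\in\mathbb{N}$, let $\mu_n$ denote the normalized counting measure on $\mathrm{Sym}(n)$. If $d$ is a left-invariant metric on $\mathrm{Sym}(\mathbb{N})$ which is compatible with (i.e., generates) the topology of pointwise convergence, then the sequence of $mm$-spaces $(\mathrm{Sym}(n),d|_{\mathrm{Sym}(n)\times\mathrm{Sym}(n)},\mu_n)_{n\in\mathbb{N}}$ dissipates, and thus fails to admit a $d_{\mathrm{conc}}$-Cauchy subsequence.
   Context: $\mathrm{Sym}(\mathbb{N})$ is the group of all permutations of $\mathbb{N}$, a topological group with the topology of pointwise convergence ($\mathbb{N}$ discrete). $\mathrm{Sym}(n)$ is regarded as the finite subgroup of $\mathrm{Sym}(\mathbb{N})$ of all permutations fixing every element other than the first $n$ elements of $\mathbb{N}$. An $mm$-space is a triple $\mathcal{X}=(X,d,\mu)$ where $(X,d)$ is a separable complete metric space and $\mu$ is a Borel probability measure on $X$. For $m\in\mathbb{N}\setminus\{0\}$ and $\kappa_0,\ldots,\kappa_m>0$, the separation distance $\mathrm{Sep}(\mathcal{X};\kappa_0,\ldots,\kappa_m)$ is the supremum, over all tuples $(B_0,\ldots,B_m)$ of Borel subsets of $X$ with $\mu(B_i)\ge\kappa_i$ for each $i$, of $\inf\{d(x,y)\mid i,j\in\{0,\ldots,m\},\ i\ne j,\ x\in B_i,\ y\in B_j\}$ (infima and suprema taken in $[0,\infty)$, so the supremum of the empty set is $0$). For $\delta>0$, a sequence of $mm$-spaces $(\mathcal{X}_n)_{n\in\mathbb{N}}$ $\delta$-dissipates if $\liminf_{n\to\infty}\mathrm{Sep}(\mathcal{X}_n;\kappa_0,\ldots,\kappa_m)\ge\delta$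 for all $m\in\mathbb{N}\setminus\{0\}$ and all $\kappa_0,\ldots,\kappa_m>0$ with $\sum_{i=0}^m\kappa_i<1$. It dissipates if it $\delta$-dissipates for some $\delta>0$. Let $\lambda$ be Lebesgue measure on $[0,1]$. For a probability measure $\mu$ and measurable real-valued $f,g$, put $\mathrm{me}_\mu(f,g)=\inf\{\epsilon>0\mid\mu(\{x\mid|f(x)-g(x)|>\epsilon\})\le\epsilon\}$. A parametrization of $\mathcal{X}$ is a Borel map $\phi\colon[0,1]\to X$ with $\phi_*(\lambda)=\mu$; every $mm$-space admits one. $\mathrm{Lip}_1(\mathcal{X})$ denotes the set of $1$-Lipschitz real-valued functions on $(X,d)$, and $\mathrm{Lip}_1(\mathcal{X})\circ\phi=\{f\circ\phi\mid f\in\mathrm{Lip}_1(\mathcal{X})\}$. The observable distance is $$d_{\mathrm{conc}}(\mathcal{X},\mathcal{Y})=\inf\{\mathrm{H}_{\mathrm{me}_\lambda}(\mathrm{Lip}_1(\mathcal{X})\circ\phi,\mathrm{Lip}_1(\mathcal{Y})\circ\psi)\mid\phi\text{ parametrization of }\mathcal{X},\ \psi\text{ parametrization of }\mathcal{Y}\},$$ where $\mathrm{H}_{\mathrm{me}_\lambda}$ is the Hausdorff distance with respect to the pseudo-metric $\mathrm{me}_\lambda$: $\mathrm{H}_{\mathrm{me}_\lambda}(A,B)$ is the infimum of all $\epsilon>0$ such that each element of $A$ is at distance $<\epsilon$ from some element of $B$ and vice versa. *)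

theory Defs
  imports "HOL-Probability.Probability_Measure"
begin

subsection \<open>Metric measure spaces\<close>

type_synonym 'a mm = "'a metric \<times> 'a measure"

abbreviation mm_metric :: "'a mm \<Rightarrow> 'a metric" where
  "mm_metric \<equiv> fst"

abbreviation mm_measure :: "'a mm \<Rightarrow> 'a measure" where
  "mm_measure \<equiv> snd"

definition mm_space :: "'a mm \<Rightarrow> bool" where
  "mm_space X \<longleftrightarrow>
     mcomplete_of (mm_metric X) \<and>
     separable_space (mtopology_of (mm_metric X)) \<and>
     space (mm_measure X) = mspace (mm_metric X) \<and>
     sets (mm_measure X) =
       sigma_sets (mspace (mm_metric X)) {U. openin (mtopology_of (mm_metric X)) U} \<and>
     prob_space (mm_measure X)"

subsection \<open>Separation distance and dissipation\<close>

text \<open>The infimum and supremum are formed in \<^typ>\<open>ennreal\<close>, so that the supremum of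
  the empty set is 0. For an mm-space, \<open>m \<ge> 1\<close> and positive \<open>\<kappa> 0, \<dots>, \<kappa> m\<close> all values
  involved are finite: sets of positive measure are nonempty, and some bounded set has measure
  so close to 1 that it meets every admissible \<open>B i\<close>.  Tuples indexed by \<open>0, \<dots>, m\<close>
  are functions on \<^typ>\<open>nat\<close> of which only the values on \<open>{0..m}\<close> matter.\<close>

definition Sep :: "'a mm \<Rightarrow> nat \<Rightarrow> (nat \<Rightarrow> real) \<Rightarrow> ennreal" where
  "Sep X m \<kappa> =
     (SUP B \<in> {B :: nat \<Rightarrow> 'a set.
                 \<forall>i\<in>{0..m}. B i \<in> sets (mm_measure X) \<and> measure (mm_measure X) (B i) \<ge> \<kappa> i}.
        Inf {ennreal (mdist (mm_metric X) x y) | x y i j.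
               i \<in> {0..m} \<and> j \<in> {0..m} \<and> i \<noteq> j \<and> x \<in> B i \<and> y \<in> B j})"

definition dissipates_by :: "real \<Rightarrow> (nat \<Rightarrow> 'a mm) \<Rightarrow> bool" where
  "dissipates_by \<delta> X \<longleftrightarrow>
     (\<forall>m \<kappa>. m \<noteq> 0 \<and> (\<forall>i\<in>{0..m}. \<kappa> i > 0) \<and> (\<Sum>i=0..m. \<kappa> i) < 1 \<longrightarrow>
        liminf (\<lambda>n. Sep (X n) m \<kappa>) \<ge> ennreal \<delta>)"

definition dissipates :: "(nat \<Rightarrow> 'a mm) \<Rightarrow> bool" where
  "dissipates X \<longleftrightarrow> (\<exists>\<delta>>0. dissipates_by \<delta> X)"

subsection \<open>Observable distance\<close>

text \<open>The real infima below are taken over sets that are bounded below by 0 and, in the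
  intended use, nonempty: for a probability measure 1 is always admissible in \<open>me\<close>, hence any
  \<open>\<epsilon> > 1\<close> in the Hausdorff distance of nonempty sets, and every mm-space has a
  parametrization.\<close>

definition me :: "'a measure \<Rightarrow> ('a \<Rightarrow> real) \<Rightarrow> ('a \<Rightarrow> real) \<Rightarrow> real" where
  "me \<mu> f g = Inf {\<epsilon>. \<epsilon> > 0 \<and> measure \<mu> {x \<in> space \<mu>. \<bar>f x - g x\<bar> > \<epsilon>} \<le> \<epsilon>}"

definition Hausdorff_dist :: "('a \<Rightarrow> 'a \<Rightarrow> real) \<Rightarrow> 'a set \<Rightarrow> 'a set \<Rightarrow> real" where
  "Hausdorff_dist \<rho> A B =
     Inf {\<epsilon>. \<epsilon> > 0 \<and> (\<forall>a\<in>A. \<exists>b\<in>B. \<rho> a b < \<epsilon>) \<and> (\<forall>b\<in>B. \<exists>a\<in>A. \<rho> b a < \<epsilon>)}"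

definition unit_interval :: "real measure" where
  "unit_interval = restrict_space lborel {0..1}"

definition parametrization :: "'a mm \<Rightarrow> (real \<Rightarrow> 'a) \<Rightarrow> bool" where
  "parametrization X \<phi> \<longleftrightarrow>
     \<phi> \<in> measurable unit_interval (mm_measure X) \<and>
     distr unit_interval (mm_measure X) \<phi> = mm_measure X"

definition Lip1 :: "'a mm \<Rightarrow> ('a \<Rightarrow> real) set" where
  "Lip1 X = {f. \<forall>x\<in>mspace (mm_metric X). \<forall>y\<in>mspace (mm_metric X).
                  \<bar>f x - f y\<bar> \<le> mdist (mm_metric X) x y}"

definition Lip1_comp :: "'a mm \<Rightarrow> (real \<Rightarrow> 'a) \<Rightarrow> (real \<Rightarrow> real) set" where
  "Lip1_comp X \<phi> = (\<lambda>f. compose {0..1} f \<phi>) ` Lip1 X"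

definition d_conc :: "'a mm \<Rightarrow> 'b mm \<Rightarrow> real" where
  "d_conc X Y =
     Inf {Hausdorff_dist (me unit_interval) (Lip1_comp X \<phi>) (Lip1_comp Y \<psi>) | \<phi> \<psi>.
            parametrization X \<phi> \<and> parametrization Y \<psi>}"

definition d_conc_Cauchy :: "(nat \<Rightarrow> 'a mm) \<Rightarrow> bool" where
  "d_conc_Cauchy X \<longleftrightarrow> (\<forall>\<epsilon>>0. \<exists>N. \<forall>m\<ge>N. \<forall>n\<ge>N. d_conc (X m) (X n) < \<epsilon>)"

subsection \<open>The symmetric groups\<close>

definition Sym_nat :: "(nat \<Rightarrow> nat) set" where
  "Sym_nat = {g. bij g}"

definition Sym :: "nat \<Rightarrow> (nat \<Rightarrow> nat) set" where
  "Sym n = {g \<in> Sym_nat. \<forall>k. k \<notin> {..<n} \<longrightarrow> g k = k}"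

definition Sym_nat_topology :: "(nat \<Rightarrow> nat) topology" where
  "Sym_nat_topology =
     subtopology (product_topology (\<lambda>_. discrete_topology UNIV) UNIV) Sym_nat"

text \<open>The group operation of \<^const>\<open>Sym_nat\<close> is composition.\<close>

definition left_invariant :: "(nat \<Rightarrow> nat) metric \<Rightarrow> bool" where
  "left_invariant d \<longleftrightarrow>
     (\<forall>g\<in>Sym_nat. \<forall>x\<in>Sym_nat. \<forall>y\<in>Sym_nat. mdist d (g \<circ> x) (g \<circ> y) = mdist d x y)"

definition Sym_mm :: "(nat \<Rightarrow> nat) metric \<Rightarrow> nat \<Rightarrow> (nat \<Rightarrow> nat) mm" where
  "Sym_mm d n = (submetric d (Sym n), uniform_count_measure (Sym n))"

end

theory Submission
  imports Defs
begin

text \<open>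
  Since the metric \<open>d\<close> generates the topology of pointwise convergence, the open stabilizer of 0 contains
  a ball of some radius \<open>\<delta> > 0\<close> about the identity, and by left invariance permutations with different
  values at 0 have distance at least \<open>\<delta>\<close> (\<open>left_invariant_separates\<close>). In \<^term>\<open>Sym n\<close> the value at 0 is
  uniformly distributed on \<open>{..<n}\<close> (\<open>measure_Sym_image_of_0\<close>), so disjoint subsets of \<open>{..<n}\<close> of
  proportions at least \<open>\<kappa> 0, \<dots>, \<kappa> m\<close> pull back to \<open>\<delta>\<close>-separated sets of these measures. Such subsets exist
  for large \<open>n\<close> when the \<open>\<kappa> i\<close> sum to less than 1, and this is \<open>\<delta>\<close>-dissipation.

  That dissipation excludes \<^const>\<open>d_conc\<close>-Cauchy subsequences is a general fact, proved here for
  sequences of finite spaces (\<open>dissipates_imp_not_d_conc_Cauchy\<close>). In a dissipating sequence, the later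
  spaces carry arbitrarily many 1-Lipschitz functions, any two of which differ by a fixed amount
  on at least a quarter of the space while taking only two values there, like the Rademacher functions
  on the unit interval. If a single finite space were \<open>\<epsilon>\<close>-close to all later ones, its 1-Lipschitz
  functions would have to approximate all these functions; but after thresholding, a function on a finite space is only a
  subset of that space, and the pigeonhole principle makes two of the Rademacher functions nearly equal.
\<close>

section \<open>Parametrizations of finite uniform spaces\<close>

lemma prob_space_unit_interval: "prob_space unit_interval"
  unfolding unit_interval_def
  by (rule prob_spaceI) (simp add: emeasure_restrict_space space_restrict_space)

lemma space_unit_interval [simp]: "space unit_interval = {0..1}"
  by (simp add: unit_interval_def space_restrict_space)

text \<open>Cut the interval into \<open>M\<close> half-open pieces of length \<open>1 / M\<close>, one for each of the \<open>M\<close> points of \<open>S\<close>.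
The existence of parametrizations matters because \<^const>\<open>d_conc\<close> is a real infimum over them: a bound
on it yields a pair of parametrizations only if there is one at all.\<close>

lemma parametrization_uniform_count_measure:
  assumes fin: "finite S" and ne: "S \<noteq> {}"
  shows "\<exists>\<phi>. parametrization (d, uniform_count_measure S) \<phi>"
proof -
  define M where "M = card S"
  have M: "0 < M" using fin ne by (simp add: M_def card_gt_0_iff)
  obtain e where e: "bij_betw e {0..<M} S"
    using ex_bij_betw_nat_finite[OF fin] unfolding M_def by blast
  \<comment> \<open>On the unit interval, the reduction modulo \<open>M\<close> only affects \<open>t = 1\<close>, which it sends back to the piece of index 0.\<close>
  define k where "k t = nat \<lfloor>t * real M\<rfloor> mod M" for t :: real
  have k_less: "k t < M" for t
    using M by (simp add: k_def)
  have k_meas: "k \<in> measurable unit_interval (count_space UNIV)"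
  proof -
    have "k \<in> measurable borel (count_space UNIV)" unfolding k_def by measurable
    then show ?thesis unfolding unit_interval_def by (intro measurable_restrict_space1) simp
  qed
  have mem: "(e \<circ> k) t \<in> S" for t
    using e k_less[of t] by (auto simp: bij_betw_def)
  have preimage: "{t \<in> {0..1}. k t = i} = {real i / M ..< (real i + 1) / M} \<union> (if i = 0 then {1} else {})"
    if i: "i < M" for i
  proof (intro set_eqI)
    fix t :: real
    consider "t < 0 \<or> t > 1" | "0 \<le> t" "t < 1" | "t = 1" by linarith
    then show "t \<in> {t \<in> {0..1}. k t = i} \<longleftrightarrow>
        t \<in> {real i / M ..< (real i + 1) / M} \<union> (if i = 0 then {1} else {})"
    proof cases
      case 1
      have "(real i + 1) / M \<le> 1" "0 \<le> real i / M" using i M by simp_all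
      then have "\<not> (real i / M \<le> t \<and> t < (real i + 1) / M)" using 1 by linarith
      then show ?thesis using 1 by auto
    next
      case 2
      have "0 \<le> t * M" "t * M < M" using 2 M by auto
      then have "nat \<lfloor>t * M\<rfloor> < M" by (simp add: nat_less_iff floor_less_iff)
      then have "k t = nat \<lfloor>t * M\<rfloor>" by (simp add: k_def)
      moreover have "nat \<lfloor>t * M\<rfloor> = i \<longleftrightarrow> \<lfloor>t * M\<rfloor> = int i"
        using \<open>0 \<le> t * M\<close> by (auto simp: nat_eq_iff)
      moreover have "\<dots> \<longleftrightarrow> t \<in> {real i / M ..< (real i + 1) / M}"
        using M by (auto simp: floor_eq_iff field_simps)
      ultimately show ?thesis using 2 by auto
    next
      case 3
      have "k t = 0" using 3 by (simp add: k_def)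
      moreover have "1 \<notin> {real i / M ..< (real i + 1) / M}" using i M by (auto simp: field_simps)
      ultimately show ?thesis using 3 by auto
    qed
  qed
  have fibre: "emeasure unit_interval {t \<in> {0..1}. k t = i} = ennreal (1 / M)" if i: "i < M" for i
  proof -
    have "emeasure unit_interval {t \<in> {0..1}. k t = i} = emeasure lborel {t \<in> {0..1}. k t = i}"
      unfolding unit_interval_def by (rule emeasure_restrict_space) auto
    also have "\<dots> = emeasure lborel {real i / M ..< (real i + 1) / M}"
      unfolding preimage[OF i] by (rule emeasure_Un_null_set) auto
    also have "\<dots> = ennreal (1 / M)"
      by (simp add: divide_right_mono diff_divide_distrib[symmetric])
    finally show ?thesis .
  qed
  have meas: "e \<circ> k \<in> measurable unit_interval (uniform_count_measure S)"
  proof (rule measurableI)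
    fix A assume "A \<in> sets (uniform_count_measure S)"
    have "(e \<circ> k) -` A \<inter> space unit_interval = k -` (e -` A) \<inter> space unit_interval" by auto
    also have "\<dots> \<in> sets unit_interval" using measurable_sets[OF k_meas] by simp
    finally show "(e \<circ> k) -` A \<inter> space unit_interval \<in> sets unit_interval" .
  qed (use mem in \<open>simp add: space_uniform_count_measure\<close>)
  have "distr unit_interval (uniform_count_measure S) (e \<circ> k) = uniform_count_measure S"
  proof (rule measure_eqI_finite[where A = S])
    fix a assume a: "a \<in> S"
    then obtain i where i: "i < M" "e i = a"
      using e by (force simp: bij_betw_def)
    have "(e \<circ> k) -` {a} \<inter> space unit_interval = {t \<in> {0..1}. k t = i}"
      using e i k_less by (auto simp: bij_betw_def inj_on_def)
    then show "emeasure (distr unit_interval (uniform_count_measure S) (e \<circ> k)) {a}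
        = emeasure (uniform_count_measure S) {a}"
      using a fin fibre[OF i(1)] meas
      by (simp add: emeasure_distr sets_uniform_count_measure emeasure_uniform_count_measure
          M_def ennreal_divide_numeral)
  qed (use fin in \<open>simp_all add: sets_uniform_count_measure\<close>)
  with meas show ?thesis by (auto simp: parametrization_def)
qed

section \<open>Consequences of a small observable distance\<close>

text \<open>A strict bound on an infimum is witnessed by some \<open>\<eta> < \<epsilon>\<close>, and the exceptional set of that \<open>\<eta>\<close> serves
as \<open>E\<close>; the value 1 is always admissible, so the infimum is not taken over the empty set.\<close>

lemma me_less_imp:
  assumes "prob_space \<mu>" and [measurable]: "f \<in> borel_measurable \<mu>" "g \<in> borel_measurable \<mu>"
    and "me \<mu> f g < \<epsilon>"
  obtains E where "E \<in> sets \<mu>" "measure \<mu> E < \<epsilon>" "\<And>x. x \<in> space \<mu> - E \<Longrightarrow> \<bar>f x - g x\<bar> < \<epsilon>"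
proof -
  interpret prob_space \<mu> by fact
  have "1 \<in> {\<epsilon>. \<epsilon> > 0 \<and> prob {x \<in> space \<mu>. \<bar>f x - g x\<bar> > \<epsilon>} \<le> \<epsilon>}" by simp
  then have "{\<epsilon>. \<epsilon> > 0 \<and> prob {x \<in> space \<mu>. \<bar>f x - g x\<bar> > \<epsilon>} \<le> \<epsilon>} \<noteq> {}" by blast
  from cInf_lessD[OF this] assms(4) obtain \<eta>
    where "prob {x \<in> space \<mu>. \<bar>f x - g x\<bar> > \<eta>} \<le> \<eta>" "\<eta> < \<epsilon>"
    unfolding me_def by blast
  then show thesis
    by (intro that[of "{x \<in> space \<mu>. \<bar>f x - g x\<bar> > \<eta>}"]) auto
qed

lemma me_le_1:
  assumes "prob_space \<mu>"
  shows "me \<mu> f g \<le> 1"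
proof -
  interpret prob_space \<mu> by fact
  show ?thesis unfolding me_def
    by (rule cInf_lower) (auto intro: bdd_belowI[of _ 0])
qed

text \<open>The uniform bound \<open>C\<close> makes the set of admissible radii nonempty, so that the real infimum is
approximated from within that set.\<close>

lemma Hausdorff_dist_less_imp:
  assumes "Hausdorff_dist \<rho> A B < \<epsilon>" "A \<noteq> {}" "B \<noteq> {}" "\<And>x y. \<rho> x y \<le> C" "b \<in> B"
  obtains a where "a \<in> A" "\<rho> b a < \<epsilon>"
proof -
  let ?H = "{\<epsilon>. \<epsilon> > 0 \<and> (\<forall>a\<in>A. \<exists>b\<in>B. \<rho> a b < \<epsilon>) \<and> (\<forall>b\<in>B. \<exists>a\<in>A. \<rho> b a < \<epsilon>)}"
  have "\<rho> x y < \<bar>C\<bar> + 1" for x y using assms(4)[of x y] by linarith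
  then have "\<bar>C\<bar> + 1 \<in> ?H" using assms(2,3) by (auto intro: add_nonneg_pos)
  then have "?H \<noteq> {}" by blast
  from cInf_lessD[OF this] assms(1) obtain \<eta> where "\<eta> \<in> ?H" "\<eta> < \<epsilon>"
    unfolding Hausdorff_dist_def by blast
  with \<open>b \<in> B\<close> that show thesis by force
qed

lemma Lip1_nonempty: "Lip1 X \<noteq> {}"
proof -
  have "(\<lambda>_. 0) \<in> Lip1 X" by (simp add: Lip1_def)
  then show ?thesis by blast
qed

text \<open>All infima in the definition of \<^const>\<open>d_conc\<close> unfolded at once: what a small observable distance gives
is a pair of parametrizations under which every 1-Lipschitz function on \<open>Y\<close> is uniformly close to
one on \<open>X\<close>, away from a set of small measure.\<close>

lemma d_conc_less_imp:
  assumes lt: "d_conc X Y < \<epsilon>"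
    and par: "\<exists>\<phi>. parametrization X \<phi>" "\<exists>\<psi>. parametrization Y \<psi>"
    and meas: "Lip1 X \<subseteq> borel_measurable (mm_measure X)" "Lip1 Y \<subseteq> borel_measurable (mm_measure Y)"
  obtains \<phi> \<psi> where "parametrization X \<phi>" "parametrization Y \<psi>"
    "\<And>g. g \<in> Lip1 Y \<Longrightarrow> \<exists>f\<in>Lip1 X. \<exists>E\<in>sets unit_interval. measure unit_interval E < \<epsilon> \<and>
       (\<forall>t\<in>{0..1} - E. \<bar>g (\<psi> t) - f (\<phi> t)\<bar> < \<epsilon>)"
proof -
  let ?D = "{Hausdorff_dist (me unit_interval) (Lip1_comp X \<phi>) (Lip1_comp Y \<psi>) | \<phi> \<psi>.
            parametrization X \<phi> \<and> parametrization Y \<psi>}"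
  have "?D \<noteq> {}" using par by blast
  from cInf_lessD[OF this] lt obtain \<phi> \<psi> where
    \<phi>: "parametrization X \<phi>" and \<psi>: "parametrization Y \<psi>" and
    H: "Hausdorff_dist (me unit_interval) (Lip1_comp X \<phi>) (Lip1_comp Y \<psi>) < \<epsilon>"
    unfolding d_conc_def by blast
  have comp_meas: "compose {0..1} f \<theta> \<in> borel_measurable unit_interval"
    if "f \<in> borel_measurable (mm_measure Z)" "parametrization Z \<theta>" for f \<theta> and Z :: "'z mm"
  proof -
    have "(\<lambda>t. f (\<theta> t)) \<in> borel_measurable unit_interval"
      using that by (auto simp: parametrization_def intro: measurable_compose)
    then show ?thesis
      by (rule measurable_cong[THEN iffD1, rotated]) (simp add: compose_def)
  qed
  show thesis
  proof (rule that[OF \<phi> \<psi>])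
    fix g assume g: "g \<in> Lip1 Y"
    have "Lip1_comp X \<phi> \<noteq> {}" "Lip1_comp Y \<psi> \<noteq> {}" "compose {0..1} g \<psi> \<in> Lip1_comp Y \<psi>"
      using g by (simp_all add: Lip1_comp_def Lip1_nonempty)
    from Hausdorff_dist_less_imp[OF H this(1,2) me_le_1[OF prob_space_unit_interval] this(3)]
    obtain f where f: "f \<in> Lip1 X" and
      close: "me unit_interval (compose {0..1} g \<psi>) (compose {0..1} f \<phi>) < \<epsilon>"
      by (auto simp: Lip1_comp_def)
    have "compose {0..1} g \<psi> \<in> borel_measurable unit_interval"
      "compose {0..1} f \<phi> \<in> borel_measurable unit_interval"
      using f g meas \<phi> \<psi> by (auto intro!: comp_meas)
    from me_less_imp[OF prob_space_unit_interval this close] obtain E where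
      E: "E \<in> sets unit_interval" "measure unit_interval E < \<epsilon>"
      and "\<And>t. t \<in> space unit_interval - E \<Longrightarrow> \<bar>compose {0..1} g \<psi> t - compose {0..1} f \<phi> t\<bar> < \<epsilon>"
      by blast
    then have "\<forall>t\<in>{0..1} - E. \<bar>g (\<psi> t) - f (\<phi> t)\<bar> < \<epsilon>"
      by (auto simp: compose_def)
    with f E show "\<exists>f\<in>Lip1 X. \<exists>E\<in>sets unit_interval. measure unit_interval E < \<epsilon> \<and>
       (\<forall>t\<in>{0..1} - E. \<bar>g (\<psi> t) - f (\<phi> t)\<bar> < \<epsilon>)" by blast
  qed
qed

section \<open>Dissipation of finite spaces excludes Cauchy subsequences\<close>

text \<open>The distance to \<open>C\<close>, cut off at \<open>s\<close>. Including \<open>s\<close> in the set of which the minimum is taken gives the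
value \<open>s\<close> also when \<open>C\<close> is empty.\<close>

definition trunc_dist :: "'a metric \<Rightarrow> real \<Rightarrow> 'a set \<Rightarrow> 'a \<Rightarrow> real" where
  "trunc_dist d s C x = Min (insert s (mdist d x ` C))"

lemma trunc_dist_in_Lip1:
  assumes "finite C" "C \<subseteq> mspace (mm_metric X)"
  shows "trunc_dist (mm_metric X) s C \<in> Lip1 X"
proof -
  let ?d = "mdist (mm_metric X)" and ?f = "trunc_dist (mm_metric X) s C"
  have le: "?f x \<le> ?f y + ?d x y" if x: "x \<in> mspace (mm_metric X)" and y: "y \<in> mspace (mm_metric X)" for x y
  proof -
    have "?f y \<in> insert s (?d y ` C)"
      unfolding trunc_dist_def using assms(1) by (intro Min_in) auto
    then consider "?f y = s" | c where "c \<in> C" "?f y = ?d y c" by blast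
    then show ?thesis
    proof cases
      case 1
      have "?f x \<le> s" unfolding trunc_dist_def using assms(1) by (intro Min_le) auto
      with 1 show ?thesis using mdist_nonneg[of "mm_metric X" x y] by linarith
    next
      case 2
      have "?f x \<le> ?d x c" unfolding trunc_dist_def using assms(1) 2 by (intro Min_le) auto
      also have "\<dots> \<le> ?d x y + ?d y c" using 2 assms(2) x y by (intro mdist_triangle) auto
      finally show ?thesis using 2 by simp
    qed
  qed
  show ?thesis
    unfolding Lip1_def
  proof (intro CollectI ballI)
    fix x y assume "x \<in> mspace (mm_metric X)" "y \<in> mspace (mm_metric X)"
    then show "\<bar>?f x - ?f y\<bar> \<le> ?d x y"
      using le[of x y] le[of y x] by (simp add: mdist_commute abs_le_iff)
  qed
qed

lemma trunc_dist_eq_0: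
  assumes "finite C" "C \<subseteq> mspace d" "x \<in> C" "0 \<le> s"
  shows "trunc_dist d s C x = 0"
  unfolding trunc_dist_def
proof (rule Min_eqI)
  show "0 \<in> insert s (mdist d x ` C)"
    using assms by (auto intro!: image_eqI[of _ _ x])
qed (use assms in auto)

lemma trunc_dist_eq:
  assumes "finite C" "\<And>c. c \<in> C \<Longrightarrow> s \<le> mdist d x c"
  shows "trunc_dist d s C x = s"
  unfolding trunc_dist_def using assms by (intro Min_eqI) auto

text \<open>A strict lower bound on the supremum is exceeded by one of its members, a tuple of pieces that are
then pairwise \<open>s\<close>-apart.\<close>

lemma Sep_greater_imp:
  assumes "ennreal s < Sep X m \<kappa>"
  obtains B where "\<And>i. i \<le> m \<Longrightarrow> B i \<in> sets (mm_measure X)"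
    "\<And>i. i \<le> m \<Longrightarrow> \<kappa> i \<le> measure (mm_measure X) (B i)"
    "\<And>i j x y. \<lbrakk>i \<le> m; j \<le> m; i \<noteq> j; x \<in> B i; y \<in> B j\<rbrakk> \<Longrightarrow> s \<le> mdist (mm_metric X) x y"
proof -
  from assms obtain B where B: "\<forall>i\<in>{0..m}. B i \<in> sets (mm_measure X) \<and> \<kappa> i \<le> measure (mm_measure X) (B i)"
    and lt: "ennreal s < Inf {ennreal (mdist (mm_metric X) x y) | x y i j.
               i \<in> {0..m} \<and> j \<in> {0..m} \<and> i \<noteq> j \<and> x \<in> B i \<and> y \<in> B j}" (is "_ < Inf ?I")
    unfolding Sep_def by (auto simp: less_SUP_iff)
  show thesis
  proof (rule that[of B])
    fix i j x y assume "i \<le> m" "j \<le> m" "i \<noteq> j" "x \<in> B i" "y \<in> B j"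
    then have "Inf ?I \<le> ennreal (mdist (mm_metric X) x y)" by (intro Inf_lower) auto
    with lt have "ennreal s \<le> ennreal (mdist (mm_metric X) x y)" by (meson less_le_trans less_imp_le)
    then show "s \<le> mdist (mm_metric X) x y" by (simp add: ennreal_le_iff)
  qed (use B in auto)
qed

text \<open>Toggling the membership of \<open>u\<close> exchanges the subsets that separate \<open>u\<close> from \<open>v\<close> with those that do not.\<close>

lemma two_card_separating_subsets:
  assumes "finite U" "u \<in> U" "u \<noteq> v"
  shows "2 * card {T \<in> Pow U. (u \<in> T) \<noteq> (v \<in> T)} = 2 ^ card U"
proof -
  let ?P = "{T \<in> Pow U. (u \<in> T) \<noteq> (v \<in> T)}" and ?Q = "{T \<in> Pow U. (u \<in> T) = (v \<in> T)}"
  define toggle where "toggle T = (if u \<in> T then T - {u} else insert u T)" for T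
  have "bij_betw toggle ?P ?Q"
    by (rule bij_betw_byWitness[where f' = toggle]) (use assms in \<open>auto simp: toggle_def\<close>)
  then have "card ?P = card ?Q" by (rule bij_betw_same_card)
  moreover have "card (?P \<union> ?Q) = card ?P + card ?Q"
    using assms by (intro card_Un_disjoint) auto
  moreover have "?P \<union> ?Q = Pow U" by auto
  ultimately show ?thesis using assms by (simp add: card_Pow)
qed

text \<open>If the subsequence were Cauchy, one finite space \<open>P\<close> would be \<open>\<epsilon>\<close>-close to all later spaces \<open>Q\<close>.
Choose \<open>K\<close> larger than the number of subsets of \<open>P\<close> and use dissipation to find in some later \<open>Q\<close>
pairwise \<open>s\<close>-separated sets \<open>C T\<close>, one for each \<open>T \<subseteq> {..<K}\<close>, each of measure at least
\<open>1 / (2 * 2 ^ K)\<close>, so that together they fill at least half of the space. Because of the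
separation there are 1-Lipschitz functions \<open>f 0, \<dots>, f (K - 1)\<close> behaving like Rademacher functions:
on \<open>C T\<close>, the function \<open>f u\<close> is \<open>s\<close> or 0 according to whether \<open>u \<in> T\<close>. Two of them differ by \<open>s\<close> on
a set of measure at least \<open>1 / 4\<close>, independently of \<open>K\<close>.

If \<open>f u\<close> is approximated by a function \<open>h u\<close> on \<open>P\<close> with error less than \<open>s / 2\<close>, the superlevel set
\<open>S u\<close> of \<open>h u\<close> at height \<open>s / 2\<close> already determines whether \<open>u \<in> T\<close>. But there are fewer subsets of
\<open>P\<close> than indices, so two indices share \<open>S\<close>, and the corresponding \<open>f u\<close> and \<open>f v\<close> must agree
on all \<open>C T\<close> outside a set of measure less than \<open>2 \<epsilon>\<close>.\<close>

lemma dissipates_imp_not_d_conc_Cauchy: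
  fixes X :: "nat \<Rightarrow> 'a mm"
  assumes diss: "dissipates X"
    and prob: "\<And>n. prob_space (mm_measure (X n))"
    and fin: "\<And>n. finite (mspace (mm_metric (X n)))"
    and sets: "\<And>n. sets (mm_measure (X n)) = Pow (mspace (mm_metric (X n)))"
    and par: "\<And>n. \<exists>\<phi>. parametrization (X n) \<phi>"
    and r: "strict_mono r"
  shows "\<not> d_conc_Cauchy (X \<circ> r)"
proof
  assume Cauchy: "d_conc_Cauchy (X \<circ> r)"
  have space: "space (mm_measure (X n)) = mspace (mm_metric (X n))" for n
    using sets_eq_imp_space_eq[of "mm_measure (X n)" "count_space (mspace (mm_metric (X n)))"]
    by (simp add: sets)
  have meas: "Lip1 (X n) \<subseteq> borel_measurable (mm_measure (X n))" for n
    by (intro subsetI measurableI) (simp_all add: sets space)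
  obtain \<delta> where \<delta>: "\<delta> > 0" "dissipates_by \<delta> X"
    using diss by (auto simp: dissipates_def)
  \<comment> \<open>Passing from \<open>\<delta>\<close> to a smaller \<open>s\<close> turns the bound on the limit inferior into a strict
    bound that holds for all large \<open>n\<close>.\<close>
  define s where "s = \<delta> / 2"
  have s: "0 < s" "s < \<delta>" using \<delta> by (auto simp: s_def)
  \<comment> \<open>The first bound makes thresholding at \<open>s / 2\<close> sound, the second gives \<open>2 \<epsilon> \<le> 1 / 4\<close>.\<close>
  define \<epsilon> where "\<epsilon> = min (s / 2) (1 / 8)"
  have \<epsilon>: "0 < \<epsilon>" "\<epsilon> \<le> s / 2" "\<epsilon> \<le> 1 / 8" using s by (auto simp: \<epsilon>_def)
  obtain N where N: "\<forall>m\<ge>N. \<forall>n\<ge>N. d_conc ((X \<circ> r) m) ((X \<circ> r) n) < \<epsilon>"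
    using Cauchy[unfolded d_conc_Cauchy_def, rule_format, OF \<epsilon>(1)] by (rule exE)
  define P where "P = X (r N)"
  define K where "K = Suc (2 ^ card (mspace (mm_metric P)))"
  \<comment> \<open>The pieces are numbered from 0 to \<open>m\<close>, so there are as many as subsets of \<open>{..<K}\<close>.\<close>
  define m where "m = 2 ^ K - (1 :: nat)"
  have m: "card {0..m} = 2 ^ K" "m \<noteq> 0"
  proof -
    have "(2 :: nat) \<le> 2 ^ K" unfolding K_def by simp
    then show "card {0..m} = 2 ^ K" "m \<noteq> 0" unfolding m_def by auto
  qed
  define \<kappa> :: real where "\<kappa> = 1 / (2 * 2 ^ K)"
  have \<kappa>: "\<kappa> > 0" "(\<Sum>i=0..m. \<kappa>) < 1"
    using m(1) by (simp_all add: \<kappa>_def)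
  have "ennreal s < ennreal \<delta>" using s by (simp add: ennreal_lessI)
  also have "\<dots> \<le> liminf (\<lambda>n. Sep (X n) m (\<lambda>_. \<kappa>))"
    using \<delta>(2)[unfolded dissipates_by_def, rule_format, of m "\<lambda>_. \<kappa>"] m(2) \<kappa> by simp
  finally have "eventually (\<lambda>n. ennreal s < Sep (X n) m (\<lambda>_. \<kappa>)) sequentially"
    by (rule less_LiminfD)
  then have "eventually (\<lambda>n. ennreal s < Sep (X (r n)) m (\<lambda>_. \<kappa>)) sequentially"
    by (rule eventually_subseq[OF r])
  then have "eventually (\<lambda>n. N \<le> n \<and> ennreal s < Sep (X (r n)) m (\<lambda>_. \<kappa>)) sequentially"
    using eventually_ge_at_top[of N] by eventually_elim simp
  from eventually_happens'[OF sequentially_bot this]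
  obtain n where n: "N \<le> n" "ennreal s < Sep (X (r n)) m (\<lambda>_. \<kappa>)" by (elim exE conjE)
  define Q where "Q = X (r n)"
  let ?U = "{..<K}"
  obtain B where B: "\<And>i. i \<le> m \<Longrightarrow> B i \<in> sets (mm_measure Q)"
    "\<And>i. i \<le> m \<Longrightarrow> \<kappa> \<le> measure (mm_measure Q) (B i)"
    "\<And>i j x y. \<lbrakk>i \<le> m; j \<le> m; i \<noteq> j; x \<in> B i; y \<in> B j\<rbrakk> \<Longrightarrow> s \<le> mdist (mm_metric Q) x y"
    using Sep_greater_imp[OF n(2)[folded Q_def]] by metis
  obtain e where e: "bij_betw e (Pow ?U) {0..m}"
    using finite_same_card_bij[of "Pow ?U" "{0..m}"] m(1) by (auto simp: card_Pow)
  define C where "C T = B (e T)" for T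
  have e_le: "e T \<le> m" if "T \<subseteq> ?U" for T
    using e that by (auto simp: bij_betw_def)
  have C_sets: "C T \<in> sets (mm_measure Q)" and C_meas: "\<kappa> \<le> measure (mm_measure Q) (C T)"
    if "T \<subseteq> ?U" for T
    using B(1,2) e_le[OF that] by (auto simp: C_def)
  have C_sub: "C T \<subseteq> mspace (mm_metric Q)" if "T \<subseteq> ?U" for T
    using C_sets[OF that] by (simp add: Q_def sets)
  have C_sep: "s \<le> mdist (mm_metric Q) x y"
    if "T \<subseteq> ?U" "T' \<subseteq> ?U" "T \<noteq> T'" "x \<in> C T" "y \<in> C T'" for T T' x y
  proof (rule B(3)[OF e_le e_le])
    show "e T \<noteq> e T'" using e that by (auto simp: bij_betw_def inj_on_def)
  qed (use that in \<open>auto simp: C_def\<close>)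
  \<comment> \<open>The union of the pieces on which \<open>f u\<close> has to vanish.\<close>
  define Z where "Z u = (\<Union>T\<in>{T \<in> Pow ?U. u \<notin> T}. C T)" for u
  have Z_sub: "Z u \<subseteq> mspace (mm_metric Q)" for u
    using C_sub by (auto simp: Z_def)
  have Z_fin: "finite (Z u)" for u
    using finite_subset[OF Z_sub] fin by (simp add: Q_def)
  define f where "f u = trunc_dist (mm_metric Q) s (Z u)" for u
  have f_in: "f u \<in> Lip1 Q" for u
    unfolding f_def by (rule trunc_dist_in_Lip1[OF Z_fin Z_sub])
  have f_eq: "f u x = (if u \<in> T then s else 0)" if "T \<subseteq> ?U" "x \<in> C T" for u x T
  proof (cases "u \<in> T")
    case True
    have "f u x = s"
      unfolding f_def
    proof (rule trunc_dist_eq[OF Z_fin])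
      fix c assume "c \<in> Z u"
      with True that C_sep show "s \<le> mdist (mm_metric Q) x c"
        unfolding Z_def by blast
    qed
    with True show ?thesis by simp
  next
    case False
    then have "x \<in> Z u" using that by (auto simp: Z_def)
    then have "f u x = 0"
      unfolding f_def using s by (intro trunc_dist_eq_0[OF Z_fin Z_sub]) auto
    with False show ?thesis by simp
  qed
  have "d_conc P Q < \<epsilon>" using N n(1) by (simp add: P_def Q_def)
  then obtain \<phi> \<psi> where \<phi>: "parametrization P \<phi>" and \<psi>: "parametrization Q \<psi>"
    and approx: "\<And>g. g \<in> Lip1 Q \<Longrightarrow> \<exists>h\<in>Lip1 P. \<exists>E\<in>sets unit_interval.
       measure unit_interval E < \<epsilon> \<and> (\<forall>t\<in>{0..1} - E. \<bar>g (\<psi> t) - h (\<phi> t)\<bar> < \<epsilon>)"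
    by (rule d_conc_less_imp) (use par meas in \<open>auto simp: P_def Q_def\<close>)
  have "\<forall>u. \<exists>h E. E \<in> sets unit_interval \<and> measure unit_interval E < \<epsilon> \<and>
      (\<forall>t\<in>{0..1} - E. \<bar>f u (\<psi> t) - h (\<phi> t)\<bar> < \<epsilon>)"
    using approx f_in by blast
  then obtain h E where E: "\<And>u. E u \<in> sets unit_interval" "\<And>u. measure unit_interval (E u) < \<epsilon>"
    and close: "\<And>u t. t \<in> {0..1} - E u \<Longrightarrow> \<bar>f u (\<psi> t) - h u (\<phi> t)\<bar> < \<epsilon>"
    by metis
  define S where "S u = {x \<in> mspace (mm_metric P). s / 2 \<le> h u x}" for u
  have fin_P: "finite (mspace (mm_metric P))" by (simp add: P_def fin)
  have "card (S ` ?U) \<le> card (Pow (mspace (mm_metric P)))"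
    by (rule card_mono) (auto simp: S_def fin_P)
  then have "card (S ` ?U) < card ?U" by (simp add: card_Pow fin_P K_def)
  then have "\<not> inj_on S ?U" by (rule pigeonhole)
  then obtain u v where uv: "u \<in> ?U" "u \<noteq> v" "S u = S v" by (auto simp: inj_on_def)
  define \<T> where "\<T> = {T \<in> Pow ?U. (u \<in> T) \<noteq> (v \<in> T)}"
  define D where "D = (\<Union>T\<in>\<T>. C T)"
  interpret Q: prob_space "mm_measure Q" by (simp add: Q_def prob)
  interpret I: prob_space unit_interval by (rule prob_space_unit_interval)
  have D_sets: "D \<in> sets (mm_measure Q)"
    unfolding D_def by (rule sets.finite_UN) (auto simp: \<T>_def C_sets)
  have "1 / 4 = (\<Sum>T\<in>\<T>. \<kappa>)"
  proof -
    have "real (2 * card \<T>) = 2 ^ K"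
      unfolding \<T>_def using two_card_separating_subsets[of ?U u v] uv by simp
    then show ?thesis by (simp add: \<kappa>_def field_simps)
  qed
  also have "\<dots> \<le> (\<Sum>T\<in>\<T>. measure (mm_measure Q) (C T))"
    by (intro sum_mono C_meas) (auto simp: \<T>_def)
  also have "\<dots> = measure (mm_measure Q) D"
    unfolding D_def
  proof (rule Q.finite_measure_finite_Union[symmetric])
    show "finite \<T>" by (simp add: \<T>_def)
    show "C ` \<T> \<subseteq> sets (mm_measure Q)" by (auto simp: \<T>_def C_sets)
    show "disjoint_family_on C \<T>"
    proof (unfold disjoint_family_on_def, intro ballI impI equals0I)
      fix T T' x assume "T \<in> \<T>" "T' \<in> \<T>" "T \<noteq> T'" "x \<in> C T \<inter> C T'"
      then have "s \<le> mdist (mm_metric Q) x x" "x \<in> mspace (mm_metric Q)"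
        using C_sep[of T T' x x] C_sub[of T] by (auto simp: \<T>_def)
      moreover from this have "mdist (mm_metric Q) x x = 0" by simp
      ultimately show False using s by simp
    qed
  qed
  also have "\<dots> = measure unit_interval (\<psi> -` D \<inter> space unit_interval)"
    using \<psi> D_sets measure_distr[of \<psi> unit_interval "mm_measure Q" D]
    by (simp add: parametrization_def)
  also have "\<dots> \<le> measure unit_interval (E u \<union> E v)"
  proof (rule I.finite_measure_mono)
    show "\<psi> -` D \<inter> space unit_interval \<subseteq> E u \<union> E v"
    proof
      fix t assume t: "t \<in> \<psi> -` D \<inter> space unit_interval"
      then obtain T where T: "T \<in> \<T>" "\<psi> t \<in> C T" by (auto simp: D_def)
      then have f: "f w (\<psi> t) = (if w \<in> T then s else 0)" for w
        by (intro f_eq) (auto simp: \<T>_def)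
      have "\<phi> t \<in> mspace (mm_metric P)"
        using \<phi> t measurable_space[of \<phi> unit_interval "mm_measure P" t]
        by (simp add: parametrization_def P_def space)
      then have "\<phi> t \<in> S w \<longleftrightarrow> w \<in> T" if "t \<notin> E w" for w
        using close[of t w] that t f[of w] \<epsilon>(2) by (auto simp: S_def abs_less_iff split: if_splits)
      then show "t \<in> E u \<union> E v" using uv(3) T(1) by (auto simp: \<T>_def)
    qed
  qed (use E in auto)
  also have "\<dots> \<le> measure unit_interval (E u) + measure unit_interval (E v)"
    using E by (intro measure_Un_le) auto
  also have "\<dots> < \<epsilon> + \<epsilon>" using E by (intro add_strict_mono) auto
  finally show False using \<epsilon>(3) by simp
qed

section \<open>The finite symmetric groups\<close>

text \<open>A finite metric space is discrete and compact, hence complete, and its Borel sets are all its subsets.\<close>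

lemma finite_metric_mm_space:
  assumes fin: "finite (mspace d)" and ne: "mspace d \<noteq> {}"
  shows "mm_space (d, uniform_count_measure (mspace d))"
proof -
  interpret Metric_space "mspace d" "mdist d" by simp
  have top: "mtopology_of d = discrete_topology (mspace d)"
    using finite_t1_space_imp_discrete_topology[of mtopology "mspace d"] fin
      Hausdorff_imp_t1_space[OF Hausdorff_space_mtopology]
    by (simp add: mtopology_of_def)
  have "compact_space mtopology"
    using top fin by (simp add: mtopology_of_def compact_space_discrete_topology)
  then have "mcomplete_of d"
    by (simp add: mcomplete_of_def compact_space_imp_mcomplete)
  moreover have "separable_space (mtopology_of d)"
    unfolding top separable_space_def using fin
    by (intro exI[of _ "mspace d"]) (simp add: discrete_topology_closure_of countable_finite)
  moreover have "sigma_sets (mspace d) {U. openin (mtopology_of d) U} = Pow (mspace d)"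
  proof
    show "sigma_sets (mspace d) {U. openin (mtopology_of d) U} \<subseteq> Pow (mspace d)"
      using sigma_sets_into_sp[of "{U. openin (mtopology_of d) U}" "mspace d"]
      by (simp add: top) blast
  qed (auto simp: top intro: sigma_sets.Basic)
  ultimately show ?thesis
    using prob_space_uniform_count_measure[OF fin ne]
    by (simp add: mm_space_def space_uniform_count_measure sets_uniform_count_measure)
qed

lemma Sym_eq: "Sym n = {g. g permutes {..<n}}"
  by (auto simp: Sym_def Sym_nat_def permutes_def bij_iff)

lemma finite_Sym: "finite (Sym n)"
  by (simp add: Sym_eq finite_permutations)

lemma id_in_Sym: "id \<in> Sym n"
  by (simp add: Sym_eq permutes_id)

text \<open>The image of 0 under a random element of \<^term>\<open>Sym n\<close> is uniformly distributed: composing with the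
transposition of 0 and \<open>j\<close> matches the permutations that send 0 to \<open>j\<close> with those that fix 0.\<close>

lemma measure_Sym_image_of_0:
  assumes "A \<subseteq> {..<n}" "0 < n"
  shows "measure (uniform_count_measure (Sym n)) {g \<in> Sym n. g 0 \<in> A} = card A / n"
proof -
  define c where "c = card {g \<in> Sym n. g 0 = 0}"
  have fibre: "card {g \<in> Sym n. g 0 = j} = c" if "j < n" for j
  proof -
    let ?t = "\<lambda>g :: nat \<Rightarrow> nat. Transposition.transpose 0 j \<circ> g"
    have t: "?t g \<in> Sym n" if "g \<in> Sym n" for g
      using that \<open>j < n\<close> assms(2) by (auto simp: Sym_eq intro!: permutes_compose permutes_swap_id)
    have "bij_betw ?t {g \<in> Sym n. g 0 = j} {g \<in> Sym n. g 0 = 0}"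
      by (rule bij_betw_byWitness[where f' = ?t]) (use t in \<open>auto simp: fun_eq_iff\<close>)
    then show ?thesis unfolding c_def by (rule bij_betw_same_card)
  qed
  have card: "card {g \<in> Sym n. g 0 \<in> A} = card A * c" if "A \<subseteq> {..<n}" for A
  proof -
    have "{g \<in> Sym n. g 0 \<in> A} = (\<Union>j\<in>A. {g \<in> Sym n. g 0 = j})" by auto
    also have "card \<dots> = (\<Sum>j\<in>A. card {g \<in> Sym n. g 0 = j})"
      using finite_subset[OF that] finite_Sym by (intro card_UN_disjoint) auto
    also have "\<dots> = card A * c" using fibre that by (simp add: subset_eq)
    finally show ?thesis .
  qed
  have "{g \<in> Sym n. g 0 \<in> {..<n}} = Sym n"
    using permutes_in_image[of _ "{..<n}" 0] assms(2) by (auto simp: Sym_eq)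
  with card[of "{..<n}"] have "card (Sym n) = n * c" by simp
  moreover have "card (Sym n) \<noteq> 0" using finite_Sym id_in_Sym by (auto simp: card_eq_0_iff)
  ultimately show ?thesis
    using card[OF assms(1)] finite_Sym by (simp add: measure_uniform_count_measure)
qed

text \<open>The stabilizer of \<open>p\<close> is a neighbourhood of the identity, so it contains a \<open>\<delta>\<close>-ball. Left translation
by the inverse of \<open>x\<close> moves a pair \<open>x, y\<close> to the identity and an element that is outside the stabilizer
whenever \<open>x p \<noteq> y p\<close>; thus distinct left cosets of the stabilizer are \<open>\<delta>\<close>-apart.\<close>

lemma left_invariant_separates:
  assumes "mspace d = Sym_nat" "left_invariant d" "mtopology_of d = Sym_nat_topology"
  shows "\<exists>\<delta>>0. \<forall>x\<in>Sym_nat. \<forall>y\<in>Sym_nat. x p \<noteq> y p \<longrightarrow> \<delta> \<le> mdist d x y"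
proof -
  interpret Metric_space "mspace d" "mdist d" by simp
  let ?V = "{g \<in> Sym_nat. g p = p}"
  have "openin (product_topology (\<lambda>_. discrete_topology UNIV) UNIV) {g :: nat \<Rightarrow> nat. g p \<in> {p}}"
    using openin_continuous_map_preimage[OF continuous_map_product_projection, of p UNIV "\<lambda>_. discrete_topology UNIV" "{p}"]
    by simp
  then have "openin Sym_nat_topology ?V"
    unfolding Sym_nat_topology_def openin_subtopology by (intro exI[of _ "{g. g p \<in> {p}}"]) auto
  then have "openin mtopology ?V"
    using assms(3) by (simp add: mtopology_of_def)
  moreover have id: "id \<in> ?V" by (simp add: Sym_nat_def)
  ultimately obtain \<delta> where \<delta>: "\<delta> > 0" "mball id \<delta> \<subseteq> ?V"
    unfolding openin_mtopology by blast
  show ?thesis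
  proof (intro exI[of _ \<delta>] conjI ballI impI \<delta>(1))
    fix x y assume xy: "x \<in> Sym_nat" "y \<in> Sym_nat" "x p \<noteq> y p"
    let ?z = "inv x \<circ> y"
    have x: "bij x" and z: "?z \<in> Sym_nat"
      using xy by (auto simp: Sym_nat_def bij_imp_bij_inv bij_comp)
    have "x \<circ> ?z = y" using x by (auto simp: fun_eq_iff bij_is_surj surj_f_inv_f)
    then have "mdist d x y = mdist d id ?z"
      using assms(2) xy(1) z id unfolding left_invariant_def by (metis (no_types, lifting) comp_id mem_Collect_eq)
    moreover have "?z p \<noteq> p"
      using xy(3) \<open>x \<circ> ?z = y\<close> by (metis comp_apply)
    then have "?z \<notin> mball id \<delta>" using \<delta>(2) by blast
    then have "\<delta> \<le> mdist d id ?z" using z id by (simp add: in_mball assms(1)[symmetric])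
    ultimately show "\<delta> \<le> mdist d x y" by simp
  qed
qed

text \<open>Consecutive intervals of lengths \<open>\<lceil>\<kappa> i * n\<rceil>\<close>. Rounding up costs less than 1 for each of the \<open>m + 1\<close>
intervals, which the slack \<open>(1 - sum of the \<kappa> i) * n\<close> absorbs once \<open>n\<close> is large.\<close>

lemma disjoint_subsets_of_proportional_card:
  fixes m :: nat and \<kappa> :: "nat \<Rightarrow> real"
  assumes "(\<Sum>i=0..m. \<kappa> i) < 1" "\<And>i. i \<le> m \<Longrightarrow> 0 \<le> \<kappa> i"
  shows "eventually (\<lambda>n. \<exists>A. (\<forall>i\<le>m. A i \<subseteq> {..<n} \<and> \<kappa> i * real n \<le> real (card (A i))) \<and>
           (\<forall>i\<le>m. \<forall>j\<le>m. i \<noteq> j \<longrightarrow> A i \<inter> A j = {})) sequentially"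
proof -
  let ?\<sigma> = "\<Sum>i=0..m. \<kappa> i"
  have "eventually (\<lambda>n. (m + 1) / (1 - ?\<sigma>) \<le> real n) sequentially"
    by (rule eventually_mono[OF eventually_ge_at_top[of "nat \<lceil>(m + 1) / (1 - ?\<sigma>)\<rceil>"]]) linarith
  then show ?thesis
  proof eventually_elim
    case (elim n)
    define a where "a i = (\<Sum>j<i. nat \<lceil>\<kappa> j * n\<rceil>)" for i
    have a_mono: "a i \<le> a j" if "i \<le> j" for i j
      unfolding a_def using that by (intro sum_mono2) auto
    have "real (a (Suc m)) = (\<Sum>i=0..m. real (nat \<lceil>\<kappa> i * n\<rceil>))"
      by (simp add: a_def lessThan_Suc_atMost atLeast0AtMost)
    also have "\<dots> \<le> (\<Sum>i=0..m. \<kappa> i * n + 1)"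
    proof (rule sum_mono)
      fix i assume "i \<in> {0..m}"
      then have "0 \<le> \<kappa> i * n" using assms(2) by simp
      then show "real (nat \<lceil>\<kappa> i * n\<rceil>) \<le> \<kappa> i * n + 1" by linarith
    qed
    also have "\<dots> = ?\<sigma> * n + (m + 1)"
      by (simp add: sum.distrib sum_distrib_right)
    also have "\<dots> \<le> n"
      using elim assms(1) by (simp add: field_simps)
    finally have a_le: "a (Suc m) \<le> n" by simp
    show ?case
    proof (intro exI[of _ "\<lambda>i. {a i..<a (Suc i)}"] conjI allI impI)
      fix i assume "i \<le> m"
      then show "{a i..<a (Suc i)} \<subseteq> {..<n}" using a_mono[of "Suc i" "Suc m"] a_le by auto
      show "\<kappa> i * n \<le> card {a i..<a (Suc i)}"
        by (simp add: a_def) linarith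
    next
      fix i j :: nat assume "i \<noteq> j"
      then show "{a i..<a (Suc i)} \<inter> {a j..<a (Suc j)} = {}"
        using a_mono[of "Suc i" j] a_mono[of "Suc j" i] by (cases i j rule: linorder_cases) auto
    qed
  qed
qed

text \<open>The pieces are unions of cosets of the stabilizer of 0: sort the permutations by which of several
disjoint subsets of \<open>{..<n}\<close> contains the image of 0.\<close>

lemma dissipates_by_Sym_mm:
  assumes sep: "\<And>x y. \<lbrakk>x \<in> Sym_nat; y \<in> Sym_nat; x 0 \<noteq> y 0\<rbrakk> \<Longrightarrow> \<delta> \<le> mdist d x y"
  shows "dissipates_by \<delta> (Sym_mm d)"
  unfolding dissipates_by_def
proof (intro allI impI Liminf_bounded)
  fix m :: nat and \<kappa> :: "nat \<Rightarrow> real"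
  assume \<kappa>: "m \<noteq> 0 \<and> (\<forall>i\<in>{0..m}. 0 < \<kappa> i) \<and> (\<Sum>i=0..m. \<kappa> i) < 1"
  have "\<forall>\<^sub>F n in sequentially. \<exists>A. (\<forall>i\<le>m. A i \<subseteq> {..<n} \<and> \<kappa> i * n \<le> card (A i)) \<and>
           (\<forall>i\<le>m. \<forall>j\<le>m. i \<noteq> j \<longrightarrow> A i \<inter> A j = {})"
    by (rule disjoint_subsets_of_proportional_card) (use \<kappa> in \<open>auto intro: less_imp_le\<close>)
  then show "\<forall>\<^sub>F n in sequentially. ennreal \<delta> \<le> Sep (Sym_mm d n) m \<kappa>"
    using eventually_gt_at_top[of 0]
  proof eventually_elim
    case (elim n)
    from elim(1) obtain A where "(\<forall>i\<le>m. A i \<subseteq> {..<n} \<and> \<kappa> i * n \<le> card (A i)) \<and>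
           (\<forall>i\<le>m. \<forall>j\<le>m. i \<noteq> j \<longrightarrow> A i \<inter> A j = {})" by (rule exE)
    then have A: "\<And>i. i \<le> m \<Longrightarrow> A i \<subseteq> {..<n}" "\<And>i. i \<le> m \<Longrightarrow> \<kappa> i * n \<le> card (A i)"
      "\<And>i j. \<lbrakk>i \<le> m; j \<le> m; i \<noteq> j\<rbrakk> \<Longrightarrow> A i \<inter> A j = {}" by simp_all
    define B where "B i = {g \<in> Sym n. g 0 \<in> A i}" for i
    have "\<kappa> i \<le> measure (uniform_count_measure (Sym n)) (B i)" if "i \<le> m" for i
      using A(2)[OF that] elim(2) by (simp add: B_def measure_Sym_image_of_0[OF A(1)[OF that]] field_simps)
    moreover have "B i \<in> sets (uniform_count_measure (Sym n))" for i
      by (auto simp: B_def sets_uniform_count_measure)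
    moreover have "\<delta> \<le> mdist d x y" if "i \<le> m" "j \<le> m" "i \<noteq> j" "x \<in> B i" "y \<in> B j" for i j x y
      using that A(3)[of i j] by (intro sep) (auto simp: B_def Sym_def)
    ultimately show "ennreal \<delta> \<le> Sep (Sym_mm d n) m \<kappa>"
      unfolding Sep_def Sym_mm_def
      by (intro SUP_upper2[of B] Inf_greatest) (auto intro: ennreal_leI)
  qed
qed

theorem corollary5p5:
  fixes d :: "(nat \<Rightarrow> nat) metric"
  assumes "mspace d = Sym_nat"
    and "left_invariant d"
    and "mtopology_of d = Sym_nat_topology"
  shows "(\<forall>n. mm_space (Sym_mm d n)) \<and>
         dissipates (Sym_mm d) \<and>
         \<not> (\<exists>r :: nat \<Rightarrow> nat. strict_mono r \<and> d_conc_Cauchy (Sym_mm d \<circ> r))"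
proof (intro conjI)
  have space: "mspace (submetric d (Sym n)) = Sym n" for n
    using assms(1) by (auto simp: Sym_def)
  show mm: "\<forall>n. mm_space (Sym_mm d n)"
    using finite_metric_mm_space[of "submetric d (Sym n)" for n] finite_Sym id_in_Sym
    unfolding Sym_mm_def space by blast
  show diss: "dissipates (Sym_mm d)"
    unfolding dissipates_def
    using left_invariant_separates[OF assms, of 0] dissipates_by_Sym_mm by blast
  show "\<not> (\<exists>r :: nat \<Rightarrow> nat. strict_mono r \<and> d_conc_Cauchy (Sym_mm d \<circ> r))"
  proof (intro notI, elim exE conjE)
    fix r :: "nat \<Rightarrow> nat" assume r: "strict_mono r" and "d_conc_Cauchy (Sym_mm d \<circ> r)"
    moreover have "\<not> d_conc_Cauchy (Sym_mm d \<circ> r)"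
    proof (rule dissipates_imp_not_d_conc_Cauchy[OF diss _ _ _ _ r])
      fix n
      show "prob_space (mm_measure (Sym_mm d n))" using mm by (simp add: mm_space_def)
      show "finite (mspace (mm_metric (Sym_mm d n)))" by (simp add: Sym_mm_def finite_Sym)
      show "sets (mm_measure (Sym_mm d n)) = Pow (mspace (mm_metric (Sym_mm d n)))"
        using space by (simp add: Sym_mm_def sets_uniform_count_measure)
      show "\<exists>\<phi>. parametrization (Sym_mm d n) \<phi>"
        unfolding Sym_mm_def using finite_Sym id_in_Sym
        by (intro parametrization_uniform_count_measure) auto
    qed
    ultimately show False by blast
  qed
qed

end
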